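(* Let $G$ be a nilpotent group of class $2$ with multiplicative Lie algebra structure $\star$. Then: (1) there is only trivial multiplicative Lie algebra structure on the commutator subgroup $[G,G]$; (2) the subgroup $G\star G$ of $G$, generated by the set $\{x\star y\mid x,y\in G\}$, is abelian; (3) the subgroup ${}^L[G,G]$ of $G$, generated by the set $\{(x\star y)^{-1}[x,y]\mid x,y\in G\}$, is abelian; (4) $MZ(G)\star MZ(G)\subseteq Z(G)$; (5) $(G\star G)\star[G,G]=1$.
   Context: Notation: ${}^xy=xyx^{-1}$ and $[x,y]=xyx^{-1}y^{-1}$. A multiplicative Lie algebra is a triple $(G,\cdot,\star)$ where $(G,\cdot)$ is a (multiplicatively written) group and $\star$ is a binary operation on $G$ (called a multiplicative Lie algebra structure on $G$) such that for all $x,y,z\in G$: (i) $x\star x=1$; (ii) $x\star(yz)=(x\star y)\,{}^y(x\star z)$; (iii) $(xy)\star z={}^x(y\star z)\,(x\star z)$; (iv) $((x\star y)\star{}^yz)((y\star z)\star{}^zx)((z\star x)\star{}^xy)=1$; (v) ${}^z(x\star y)=({}^zx)\star({}^zy)$. The trivial structure is the one with $x\star y=1$ for all $x,y$. A group $G$ is nilpotent of class $2$ if $[G,G]\subseteq Z(G)$, where $Z(G)$ is the center and $[G,G]$ the commutator subgroup. Put ${}^L[a,b]=(a\star b)^{-1}[a,b]$. The multiplicative Lie center is $MZ(G)=\{a\in G: {}^L[a,b]=1\ \text{for all } b\in G\}$. For subgroups $A,B$ of $G$, $A\star B$ denotes the subgroup of $G$ generated by $\{a\star b\mid a\in A,b\in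 B\}$.
   Formalization: In (1), "only trivial structure on [G,G]" is taken to mean that the given structure ⋆ on G restricts to a trivial structure on [G,G]; for arbitrary structures on [G,G] the claim fails (e.g. [G,G]=Z³ with the cross product, G free of class 2 on 3 generators). *)

theory Defs
  imports "HOL-Algebra.Generated_Groups"
begin

definition conj_by :: "('a, 'b) monoid_scheme \<Rightarrow> 'a \<Rightarrow> 'a \<Rightarrow> 'a" where
  "conj_by G x y = x \<otimes>\<^bsub>G\<^esub> y \<otimes>\<^bsub>G\<^esub> inv\<^bsub>G\<^esub> x"

text \<open>This is the convention of \<^const>\<open>derived\<close>:
  \<^term>\<open>derived G (carrier G)\<close> is generated by the elements \<open>[x, y]\<close> below.\<close>

definition commutator :: "('a, 'b) monoid_scheme \<Rightarrow> 'a \<Rightarrow> 'a \<Rightarrow> 'a" where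
  "commutator G x y = x \<otimes>\<^bsub>G\<^esub> y \<otimes>\<^bsub>G\<^esub> inv\<^bsub>G\<^esub> x \<otimes>\<^bsub>G\<^esub> inv\<^bsub>G\<^esub> y"

definition center :: "('a, 'b) monoid_scheme \<Rightarrow> 'a set" where
  "center G = {z \<in> carrier G. \<forall>x \<in> carrier G. z \<otimes>\<^bsub>G\<^esub> x = x \<otimes>\<^bsub>G\<^esub> z}"

text \<open>As in the source, this includes the abelian groups (class at most 2).\<close>

definition nilpotent_class_2 :: "('a, 'b) monoid_scheme \<Rightarrow> bool" where
  "nilpotent_class_2 G \<longleftrightarrow> group G \<and> derived G (carrier G) \<subseteq> center G"

locale mult_lie_algebra = group G for G (structure) +
  fixes star :: "'a \<Rightarrow> 'a \<Rightarrow> 'a" (infixl \<open>\<star>\<close> 75)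
  assumes star_closed: "\<lbrakk>x \<in> carrier G; y \<in> carrier G\<rbrakk> \<Longrightarrow> x \<star> y \<in> carrier G"
    and star_self: "x \<in> carrier G \<Longrightarrow> x \<star> x = \<one>"
    and star_mult_right: "\<lbrakk>x \<in> carrier G; y \<in> carrier G; z \<in> carrier G\<rbrakk> \<Longrightarrow>
      x \<star> (y \<otimes> z) = (x \<star> y) \<otimes> conj_by G y (x \<star> z)"
    and star_mult_left: "\<lbrakk>x \<in> carrier G; y \<in> carrier G; z \<in> carrier G\<rbrakk> \<Longrightarrow>
      (x \<otimes> y) \<star> z = conj_by G x (y \<star> z) \<otimes> (x \<star> z)"
    and star_jacobi: "\<lbrakk>x \<in> carrier G; y \<in> carrier G; z \<in> carrier G\<rbrakk> \<Longrightarrow>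
      ((x \<star> y) \<star> conj_by G y z) \<otimes> ((y \<star> z) \<star> conj_by G z x)
        \<otimes> ((z \<star> x) \<star> conj_by G x y) = \<one>"
    and star_conj: "\<lbrakk>x \<in> carrier G; y \<in> carrier G; z \<in> carrier G\<rbrakk> \<Longrightarrow>
      conj_by G z (x \<star> y) = conj_by G z x \<star> conj_by G z y"

definition trivial_structure :: "('a, 'b) monoid_scheme \<Rightarrow> ('a \<Rightarrow> 'a \<Rightarrow> 'a) \<Rightarrow> bool" where
  "trivial_structure G star \<longleftrightarrow> (\<forall>x \<in> carrier G. \<forall>y \<in> carrier G. star x y = \<one>\<^bsub>G\<^esub>)"

definition star_subgroup ::
    "('a, 'b) monoid_scheme \<Rightarrow> ('a \<Rightarrow> 'a \<Rightarrow> 'a) \<Rightarrow> 'a set \<Rightarrow> 'a set \<Rightarrow> 'a set" where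
  "star_subgroup G star A B = generate G {star a b | a b. a \<in> A \<and> b \<in> B}"

definition lie_commutator ::
    "('a, 'b) monoid_scheme \<Rightarrow> ('a \<Rightarrow> 'a \<Rightarrow> 'a) \<Rightarrow> 'a \<Rightarrow> 'a \<Rightarrow> 'a" where
  "lie_commutator G star a b = inv\<^bsub>G\<^esub> (star a b) \<otimes>\<^bsub>G\<^esub> commutator G a b"

definition lie_commutator_subgroup ::
    "('a, 'b) monoid_scheme \<Rightarrow> ('a \<Rightarrow> 'a \<Rightarrow> 'a) \<Rightarrow> 'a set" where
  "lie_commutator_subgroup G star =
     generate G {lie_commutator G star x y | x y. x \<in> carrier G \<and> y \<in> carrier G}"

definition mult_lie_center ::
    "('a, 'b) monoid_scheme \<Rightarrow> ('a \<Rightarrow> 'a \<Rightarrow> 'a) \<Rightarrow> 'a set" where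
  "mult_lie_center G star =
     {a \<in> carrier G. \<forall>b \<in> carrier G. lie_commutator G star a b = \<one>\<^bsub>G\<^esub>}"

end

theory Submission
  imports Defs
begin

text \<open>
  In a group of class 2 every commutator is central, so conjugation by \<open>x\<close> multiplies \<open>u\<close> by the
  central element \<open>[x, u]\<close>, and conjugating by a commutator does nothing. Expanding a \<open>\<star>\<close>-product
  of products in two orders then gives identities of low complexity.

  \<^item> Expanding \<open>(xy) \<star> (zw)\<close> by the left rule first, and by the right rule first, shows that
    \<open>x \<star> z\<close> carries the conjugate of \<open>y \<star> w\<close> by \<open>zx\<close> to its conjugate by \<open>xz\<close>. As \<open>xz\<close> and \<open>zx\<close>
    differ by a commutator, the two conjugates agree, so all \<open>\<star>\<close>-products commute
    (\<open>star_commute\<close>). Hence \<open>G \<star> G\<close> is abelian, and so is the subgroup generated by the elements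
    \<open>(x \<star> y)\<^sup>-\<^sup>1 [x, y]\<close>, which are \<open>\<star>\<close>-products times central elements.

  \<^item> Comparing \<open>xy \<star> z\<close> with \<open>yx \<star> z\<close> gives \<open>[x, y] \<star> z = [x, y \<star> z] [y, z \<star> x]\<close>
    (\<open>commutator_star_eq\<close>). In particular \<open>[x, y] \<star> z\<close> is central; then the same formula
    kills the product of two commutators.

  \<^item> Compatibility with conjugation (\<open>star_conj\<close>), with the conjugates written as a commutator times an element, turns this into the
    cyclic identity \<open>[x, y \<star> z] [y, z \<star> x] [z, x \<star> y] = 1\<close>. Together the two formulas say
    \<open>[x, y] \<star> z = [x \<star> y, z]\<close> (\<open>commutator_star\<close>).

  The last formula contains the rest: the right-hand side is trivial when \<open>z\<close> is central, so
  \<open>\<star>\<close> vanishes on the commutator subgroup; it is also trivial when \<open>z \<in> G \<star> G\<close>, because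
  \<open>G \<star> G\<close> is abelian. Finally, on the multiplicative Lie center \<open>a \<star> b\<close> is the commutator
  \<open>[a, b]\<close>, which is central.
\<close>

section \<open>Commutators, conjugation and the center\<close>

text \<open>Commuting with a fixed element passes from generators to the generated subgroup; this is
  applied once for each of the two factors.\<close>

lemma (in group) comm_group_generate:
  assumes A: "A \<subseteq> carrier G" and comm: "\<And>a b. \<lbrakk>a \<in> A; b \<in> A\<rbrakk> \<Longrightarrow> a \<otimes> b = b \<otimes> a"
  shows "comm_group (G\<lparr>carrier := generate G A\<rparr>)"
proof -
  have com: "x \<otimes> b = b \<otimes> x" if "x \<in> generate G A" "b \<in> carrier G" "\<And>a. a \<in> A \<Longrightarrow> a \<otimes> b = b \<otimes> a" for x b
    using that(1)
  proof induction
    case one show ?case using that by simp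
  next
    case (incl h) thus ?case using that by simp
  next
    case (inv h)
    hence h: "h \<in> carrier G" "h \<otimes> b = b \<otimes> h" using that A by auto
    have "inv h \<otimes> b = inv h \<otimes> (b \<otimes> h) \<otimes> inv h" using h that(2) by (simp add: m_assoc)
    also have "\<dots> = inv h \<otimes> (h \<otimes> b) \<otimes> inv h" using h by simp
    also have "\<dots> = b \<otimes> inv h" using h(1) that(2) by (simp add: m_assoc[symmetric])
    finally show ?case .
  next
    case (eng h1 h2)
    hence h: "h1 \<in> carrier G" "h2 \<in> carrier G" using generate_in_carrier[OF A] by auto
    have "h1 \<otimes> h2 \<otimes> b = h1 \<otimes> (b \<otimes> h2)" using h that(2) eng by (simp add: m_assoc)
    also have "\<dots> = b \<otimes> h1 \<otimes> h2" using h that(2) eng by (simp add: m_assoc[symmetric])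
    finally show ?case using h that(2) by (simp add: m_assoc)
  qed
  have "x \<otimes> y = y \<otimes> x" if x: "x \<in> generate G A" and y: "y \<in> generate G A" for x y
    using com[OF x generate_in_carrier[OF A y]] com[OF y] comm A by (metis subsetD)
  thus ?thesis
    using subgroup_imp_group[OF generate_is_subgroup[OF A]]
    by (auto intro!: group.group_comm_groupI)
qed

lemma commutator_in_derived:
  assumes "x \<in> carrier G" "y \<in> carrier G"
  shows "commutator G x y \<in> derived G (carrier G)"
  using assms unfolding derived_def commutator_def by (auto intro!: generate.incl)

context group
begin

lemma conj_by_closed [simp]: "\<lbrakk>x \<in> carrier G; y \<in> carrier G\<rbrakk> \<Longrightarrow> conj_by G x y \<in> carrier G"
  by (simp add: conj_by_def)

lemma commutator_closed [simp]:
  "\<lbrakk>x \<in> carrier G; y \<in> carrier G\<rbrakk> \<Longrightarrow> commutator G x y \<in> carrier G"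
  by (simp add: commutator_def)

lemma conj_by_eq_commutator_mult:
  "\<lbrakk>x \<in> carrier G; y \<in> carrier G\<rbrakk> \<Longrightarrow> conj_by G x y = commutator G x y \<otimes> y"
  by (simp add: conj_by_def commutator_def m_assoc)

lemma inv_mult_cancel_left: "\<lbrakk>x \<in> carrier G; y \<in> carrier G\<rbrakk> \<Longrightarrow> inv x \<otimes> (x \<otimes> y) = y"
  by (simp flip: m_assoc)

lemma mult_eq_commutator_mult:
  "\<lbrakk>x \<in> carrier G; y \<in> carrier G\<rbrakk> \<Longrightarrow> x \<otimes> y = commutator G x y \<otimes> (y \<otimes> x)"
  by (simp add: commutator_def m_assoc inv_mult_cancel_left)

lemma conj_by_mult:
  "\<lbrakk>x \<in> carrier G; y \<in> carrier G; z \<in> carrier G\<rbrakk>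
    \<Longrightarrow> conj_by G x (y \<otimes> z) = conj_by G x y \<otimes> conj_by G x z"
  by (simp add: conj_by_def m_assoc inv_mult_cancel_left)

lemma conj_by_conj_by:
  "\<lbrakk>x \<in> carrier G; y \<in> carrier G; z \<in> carrier G\<rbrakk>
    \<Longrightarrow> conj_by G x (conj_by G y z) = conj_by G (x \<otimes> y) z"
  by (simp add: conj_by_def m_assoc inv_mult_group)

lemma conj_by_one [simp]: "y \<in> carrier G \<Longrightarrow> conj_by G \<one> y = y"
  by (simp add: conj_by_def)

lemma conj_by_one_right [simp]: "x \<in> carrier G \<Longrightarrow> conj_by G x \<one> = \<one>"
  by (simp add: conj_by_def)

lemma inv_commutator:
  "\<lbrakk>x \<in> carrier G; y \<in> carrier G\<rbrakk> \<Longrightarrow> inv (commutator G x y) = commutator G y x"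
  by (simp add: commutator_def m_assoc inv_mult_group)

lemma commutator_eq_one_iff:
  "\<lbrakk>x \<in> carrier G; y \<in> carrier G\<rbrakk> \<Longrightarrow> commutator G x y = \<one> \<longleftrightarrow> x \<otimes> y = y \<otimes> x"
  by (metis commutator_closed l_one m_closed mult_eq_commutator_mult r_cancel_one)

lemma center_carrier: "z \<in> center G \<Longrightarrow> z \<in> carrier G"
  by (simp add: center_def)

lemma center_commute: "\<lbrakk>z \<in> center G; x \<in> carrier G\<rbrakk> \<Longrightarrow> z \<otimes> x = x \<otimes> z"
  by (simp add: center_def)

lemma center_subgroup: "subgroup (center G) G"
proof (rule subgroupI)
  show "center G \<subseteq> carrier G" by (auto simp: center_def)
  show "center G \<noteq> {}" by (auto simp: center_def intro!: exI[of _ \<one>])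
  show "inv a \<in> center G" if a: "a \<in> center G" for a
    using a unfolding center_def
    by (auto simp: inv_solve_right m_assoc) (metis inv_mult_cancel_left)
  show "a \<otimes> b \<in> center G" if a: "a \<in> center G" and b: "b \<in> center G" for a b
  proof -
    have "a \<otimes> b \<otimes> x = x \<otimes> (a \<otimes> b)" if x: "x \<in> carrier G" for x
    proof -
      have "a \<otimes> b \<otimes> x = a \<otimes> (b \<otimes> x)"
        using a b x by (simp add: center_carrier m_assoc)
      also have "b \<otimes> x = x \<otimes> b" using b x by (rule center_commute)
      also have "a \<otimes> (x \<otimes> b) = (a \<otimes> x) \<otimes> b"
        using a b x by (simp add: center_carrier m_assoc)
      also have "a \<otimes> x = x \<otimes> a" using a x by (rule center_commute)
      finally show ?thesis using a b x by (simp add: center_carrier m_assoc)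
    qed
    moreover have "a \<otimes> b \<in> carrier G" using a b by (simp add: center_carrier)
    ultimately show ?thesis unfolding center_def by blast
  qed
qed

lemma conj_by_center: "\<lbrakk>z \<in> center G; x \<in> carrier G\<rbrakk> \<Longrightarrow> conj_by G z x = x"
  by (simp add: conj_by_def center_commute center_carrier m_assoc)

end

section \<open>Identities in an arbitrary multiplicative Lie algebra\<close>

context mult_lie_algebra
begin

declare star_closed [simp]

lemma one_star [simp]: "z \<in> carrier G \<Longrightarrow> \<one> \<star> z = \<one>"
  using star_mult_left[of \<one> \<one> z] by (simp add: l_cancel_one)

text \<open>The usual polarization: expand \<open>(yx) \<star> (yx) = 1\<close>; the result is the claim conjugated
  by \<open>y\<close>.\<close>

lemma star_mult_star_swap:
  assumes x: "x \<in> carrier G" and y: "y \<in> carrier G"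
  shows "(x \<star> y) \<otimes> (y \<star> x) = \<one>"
proof -
  have "\<one> = (y \<otimes> x) \<star> (y \<otimes> x)" using x y by (simp add: star_self)
  also have "\<dots> = conj_by G y (x \<star> (y \<otimes> x)) \<otimes> (y \<star> (y \<otimes> x))"
    using x y by (simp add: star_mult_left)
  also have "x \<star> (y \<otimes> x) = x \<star> y" using x y by (simp add: star_mult_right star_self)
  also have "y \<star> (y \<otimes> x) = conj_by G y (y \<star> x)" using x y by (simp add: star_mult_right star_self)
  also have "conj_by G y (x \<star> y) \<otimes> conj_by G y (y \<star> x) = conj_by G y ((x \<star> y) \<otimes> (y \<star> x))"
    using x y by (simp add: conj_by_mult)
  finally have "conj_by G y ((x \<star> y) \<otimes> (y \<star> x)) = \<one>" by simp
  hence "conj_by G (inv y) (conj_by G y ((x \<star> y) \<otimes> (y \<star> x))) = \<one>" using y by simp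
  thus ?thesis using x y by (simp add: conj_by_conj_by)
qed

lemma inv_star: "\<lbrakk>x \<in> carrier G; y \<in> carrier G\<rbrakk> \<Longrightarrow> inv (x \<star> y) = y \<star> x"
  by (simp add: inv_equality star_mult_star_swap)

text \<open>A central factor makes the twist in the distributive laws disappear.\<close>

lemma center_mult_star:
  "\<lbrakk>c \<in> center G; x \<in> carrier G; z \<in> carrier G\<rbrakk> \<Longrightarrow> (c \<otimes> x) \<star> z = (x \<star> z) \<otimes> (c \<star> z)"
  by (simp add: star_mult_left conj_by_center center_carrier)

lemma star_center_mult:
  "\<lbrakk>c \<in> center G; x \<in> carrier G; z \<in> carrier G\<rbrakk> \<Longrightarrow> z \<star> (c \<otimes> x) = (z \<star> c) \<otimes> (z \<star> x)"
  by (simp add: star_mult_right conj_by_center center_carrier)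

text \<open>The two orders of expanding \<open>(xy) \<star> (zw)\<close> share their outer factors and differ in the middle,
  which is the equation below. It says that conjugating by \<open>x \<star> z\<close> has the same effect on
  \<open>\<star>\<close>-products as conjugating by \<open>[x, z]\<close>.\<close>

lemma conj_star_mult_star:
  assumes "x \<in> carrier G" "y \<in> carrier G" "z \<in> carrier G" "w \<in> carrier G"
  shows "conj_by G (x \<otimes> z) (y \<star> w) \<otimes> (x \<star> z) = (x \<star> z) \<otimes> conj_by G (z \<otimes> x) (y \<star> w)"
proof -
  let ?a = "conj_by G x (y \<star> z)" and ?b = "conj_by G z (x \<star> w)"
  let ?l = "conj_by G (x \<otimes> z) (y \<star> w) \<otimes> (x \<star> z)"
  let ?r = "(x \<star> z) \<otimes> conj_by G (z \<otimes> x) (y \<star> w)"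
  have "(x \<otimes> y) \<star> (z \<otimes> w) = ?a \<otimes> ?l \<otimes> ?b"
    using assms
    by (subst star_mult_left)
       (simp_all add: star_mult_right conj_by_mult conj_by_conj_by m_assoc)
  moreover have "(x \<otimes> y) \<star> (z \<otimes> w) = ?a \<otimes> ?r \<otimes> ?b"
    using assms
    by (subst star_mult_right)
       (simp_all add: star_mult_left conj_by_mult conj_by_conj_by m_assoc)
  ultimately have "?a \<otimes> ?l \<otimes> ?b = ?a \<otimes> ?r \<otimes> ?b" by simp
  thus ?thesis using assms by simp
qed

end

section \<open>Multiplicative Lie algebras of nilpotency class 2\<close>

locale class_2_mult_lie_algebra = mult_lie_algebra +
  assumes derived_le_center: "derived G (carrier G) \<subseteq> center G"
begin

lemma commutator_center: "\<lbrakk>x \<in> carrier G; y \<in> carrier G\<rbrakk> \<Longrightarrow> commutator G x y \<in> center G"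
  by (rule subsetD[OF derived_le_center commutator_in_derived])

text \<open>A case of the bilinearity of commutators in class 2.\<close>

lemma commutator_inv_right:
  assumes x: "x \<in> carrier G" and u: "u \<in> carrier G"
  shows "commutator G x (inv u) = inv (commutator G x u)"
proof -
  have "commutator G x (inv u) \<otimes> commutator G x u
      = commutator G x (inv u) \<otimes> (commutator G x u \<otimes> inv u) \<otimes> u"
    using x u by (simp add: m_assoc)
  also have "commutator G x u \<otimes> inv u = inv u \<otimes> commutator G x u"
    using x u by (simp add: center_commute commutator_center)
  also have "commutator G x (inv u) \<otimes> (inv u \<otimes> commutator G x u) \<otimes> u
      = conj_by G x (inv u) \<otimes> conj_by G x u"
    using x u by (simp add: conj_by_eq_commutator_mult m_assoc)
  also have "\<dots> = \<one>" using x u by (simp flip: conj_by_mult)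
  finally have "commutator G x (inv u) \<otimes> commutator G x u = \<one>" .
  from inv_equality[OF this] show ?thesis using x u by simp
qed

lemma star_commute:
  assumes x: "x \<in> carrier G" and z: "z \<in> carrier G" and y: "y \<in> carrier G" and w: "w \<in> carrier G"
  shows "(x \<star> z) \<otimes> (y \<star> w) = (y \<star> w) \<otimes> (x \<star> z)"
proof -
  \<comment> \<open>Undo the conjugation in \<open>conj_star_mult_star\<close>: by \<open>star_conj\<close>, \<open>y \<star> w\<close> is itself a
    conjugate by \<open>zx\<close> of a \<open>\<star>\<close>-product.\<close>
  define g where "g = inv (z \<otimes> x)"
  have g: "g \<in> carrier G" using x z by (simp add: g_def)
  let ?u = "conj_by G g y \<star> conj_by G g w"
  have zx: "conj_by G (z \<otimes> x) ?u = y \<star> w"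
    using x z y w g by (simp flip: star_conj add: conj_by_conj_by) (simp add: g_def)
  have "conj_by G (x \<otimes> z) ?u = conj_by G (commutator G x z) (conj_by G (z \<otimes> x) ?u)"
    using x z y w g by (simp add: conj_by_conj_by mult_eq_commutator_mult[of x z])
  also have "\<dots> = y \<star> w"
    using x z y w commutator_center[of x z] zx by (simp add: conj_by_center)
  finally show ?thesis
    using conj_star_mult_star[OF x _ z, of "conj_by G g y" "conj_by G g w"] zx x y z w g by simp
qed

text \<open>Apply \<open>\<star> z\<close> to \<open>xy = [x, y] yx\<close>. With \<open>p = y \<star> z\<close> and \<open>q = x \<star> z\<close>, which commute, the left
  side becomes \<open>[x, p] p q\<close> and the right side \<open>[y, q] q p\<close> times \<open>[x, y] \<star> z\<close>; cancel \<open>p q\<close>.\<close>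

lemma commutator_star_eq:
  assumes x: "x \<in> carrier G" and y: "y \<in> carrier G" and z: "z \<in> carrier G"
  shows "commutator G x y \<star> z = commutator G x (y \<star> z) \<otimes> commutator G y (z \<star> x)"
proof -
  let ?p = "y \<star> z" and ?q = "x \<star> z"
  note [simp] = x y z
  have "commutator G y ?q \<otimes> ((?p \<otimes> ?q) \<otimes> (commutator G x y \<star> z))
      = (commutator G y ?q \<otimes> ?q \<otimes> ?p) \<otimes> (commutator G x y \<star> z)"
    unfolding star_commute[OF y z x z] by (simp add: m_assoc)
  also have "\<dots> = ((y \<otimes> x) \<star> z) \<otimes> (commutator G x y \<star> z)"
    by (simp add: star_mult_left conj_by_eq_commutator_mult)
  also have "\<dots> = (x \<otimes> y) \<star> z"
    by (simp add: mult_eq_commutator_mult[of x y] center_mult_star commutator_center)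
  also have "\<dots> = commutator G x ?p \<otimes> (?p \<otimes> ?q)"
    by (simp add: star_mult_left conj_by_eq_commutator_mult m_assoc)
  also have "\<dots> = (?p \<otimes> ?q) \<otimes> commutator G x ?p"
    by (rule center_commute) (simp_all add: commutator_center)
  finally have "(?p \<otimes> ?q) \<otimes> (commutator G x y \<star> z)
      = inv (commutator G y ?q) \<otimes> ((?p \<otimes> ?q) \<otimes> commutator G x ?p)"
    by (simp add: inv_solve_left)
  also have "inv (commutator G y ?q) = commutator G y (z \<star> x)"
    by (simp add: commutator_inv_right[symmetric] inv_star)
  also have "\<dots> \<otimes> ((?p \<otimes> ?q) \<otimes> commutator G x ?p)
      = (?p \<otimes> ?q) \<otimes> (commutator G x ?p \<otimes> commutator G y (z \<star> x))"
    by (subst center_commute) (simp_all add: commutator_center m_assoc)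
  finally show ?thesis by simp
qed

lemma commutator_star_center:
  assumes "x \<in> carrier G" "y \<in> carrier G" "z \<in> carrier G"
  shows "commutator G x y \<star> z \<in> center G"
  using assms
  by (simp add: commutator_star_eq subgroup.m_closed[OF center_subgroup] commutator_center)

lemma commutator_center_right:
  "\<lbrakk>x \<in> carrier G; c \<in> center G\<rbrakk> \<Longrightarrow> commutator G x c = \<one>"
  by (simp add: commutator_eq_one_iff center_carrier center_commute[symmetric])

text \<open>In \<open>[a, b \<star> c] [b, c \<star> a]\<close> with \<open>c = [x, y]\<close>, both \<open>\<star>\<close>-products contain a commutator and
  so are central.\<close>

lemma commutator_star_commutator:
  assumes [simp]: "a \<in> carrier G" "b \<in> carrier G" "x \<in> carrier G" "y \<in> carrier G"
  shows "commutator G a b \<star> commutator G x y = \<one>"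
proof -
  let ?c = "commutator G x y"
  have "b \<star> ?c \<in> center G"
    using commutator_star_center[of x y b] inv_star[of ?c b] subgroup.m_inv_closed[OF center_subgroup]
    by force
  thus ?thesis
    by (simp add: commutator_star_eq[of a b] commutator_center_right commutator_star_center)
qed

text \<open>Conjugating \<open>x \<star> y\<close> by \<open>z\<close> multiplies it by \<open>[z, x \<star> y]\<close>. By \<open>star_conj\<close> the same conjugate is
  \<open>[z, x] x \<star> [z, y] y\<close>, whose expansion has the correction terms \<open>x \<star> [z, y]\<close> and
  \<open>[z, x] \<star> y\<close> only, since \<open>\<star>\<close> kills pairs of commutators. In terms of the three factors
  \<open>A, B, C\<close> of the claim this reads \<open>C = (B C) (C A)\<close>, that is, \<open>A B C = 1\<close>.\<close>

lemma commutator_star_cyclic: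
  assumes [simp]: "x \<in> carrier G" "y \<in> carrier G" "z \<in> carrier G"
  shows "commutator G x (y \<star> z) \<otimes> commutator G y (z \<star> x) \<otimes> commutator G z (x \<star> y) = \<one>"
proof -
  let ?A = "commutator G x (y \<star> z)" and ?B = "commutator G y (z \<star> x)" and ?C = "commutator G z (x \<star> y)"
  have cen: "?A \<in> center G" "?B \<in> center G" "?C \<in> center G" by (simp_all add: commutator_center)
  have 1: "commutator G z x \<star> y = ?C \<otimes> ?A" by (simp add: commutator_star_eq)
  have "commutator G z (y \<star> x) = inv ?C" "commutator G y (x \<star> z) = inv ?B"
    by (simp_all add: commutator_inv_right[symmetric] inv_star)
  hence "commutator G z y \<star> x = inv ?C \<otimes> inv ?B" by (simp add: commutator_star_eq)
  hence 2: "x \<star> commutator G z y = ?B \<otimes> ?C"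
    using inv_star[of "commutator G z y" x] by (simp add: inv_mult_group)
  have "?C \<otimes> (x \<star> y) = conj_by G z x \<star> conj_by G z y"
    by (simp add: star_conj flip: conj_by_eq_commutator_mult)
  also have "\<dots> = (x \<star> commutator G z y) \<otimes> (x \<star> y) \<otimes> (commutator G z x \<star> y)"
    by (simp add: conj_by_eq_commutator_mult center_mult_star star_center_mult commutator_center
          commutator_star_commutator m_assoc)
  also have "\<dots> = (?A \<otimes> ?B \<otimes> ?C) \<otimes> (?C \<otimes> (x \<star> y))"
  proof -
    have "(?B \<otimes> ?C) \<otimes> (x \<star> y) \<otimes> (?C \<otimes> ?A) = (?C \<otimes> ?A) \<otimes> ((?B \<otimes> ?C) \<otimes> (x \<star> y))"
      using cen by (intro center_commute[symmetric] subgroup.m_closed[OF center_subgroup]) simp_all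
    also have "\<dots> = ?C \<otimes> (?A \<otimes> ?B \<otimes> ?C) \<otimes> (x \<star> y)" by (simp add: m_assoc)
    also have "?C \<otimes> (?A \<otimes> ?B \<otimes> ?C) = (?A \<otimes> ?B \<otimes> ?C) \<otimes> ?C"
      using cen by (intro center_commute) simp_all
    finally show ?thesis unfolding 1 2 by (simp add: m_assoc)
  qed
  finally show ?thesis by (simp add: l_cancel_one')
qed

lemma commutator_star:
  assumes [simp]: "x \<in> carrier G" "y \<in> carrier G" "z \<in> carrier G"
  shows "commutator G x y \<star> z = commutator G (x \<star> y) z"
  using commutator_star_cyclic[of x y z] inv_equality[of "commutator G x y \<star> z" "commutator G z (x \<star> y)"]
  by (simp add: commutator_star_eq[symmetric] inv_commutator[symmetric, of z])

lemma derived_center: "d \<in> derived G (carrier G) \<Longrightarrow> d \<in> center G"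
  by (rule subsetD[OF derived_le_center])

text \<open>For fixed \<open>u\<close>, the map \<open>d \<mapsto> d \<star> u\<close> is multiplicative on central elements, so it is enough to
  test it on the generators of the commutator subgroup.\<close>

lemma derived_star_eq_one:
  assumes u: "u \<in> carrier G"
    and one: "\<And>a b. \<lbrakk>a \<in> carrier G; b \<in> carrier G\<rbrakk> \<Longrightarrow> commutator G a b \<star> u = \<one>"
    and d: "d \<in> derived G (carrier G)"
  shows "d \<star> u = \<one>"
proof -
  have "d \<star> u = \<one>" if "d \<in> generate G (derived_set G (carrier G))" for d
    using that
  proof induction
    case one thus ?case using u by simp
  next
    case (incl h) thus ?case using one by (auto simp: commutator_def)
  next
    case (inv h)
    then obtain a b where h: "h = commutator G a b" "a \<in> carrier G" "b \<in> carrier G"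
      by (auto simp: commutator_def)
    hence "inv h = commutator G b a" by (simp add: inv_commutator)
    thus ?case using h one by simp
  next
    case (eng h1 h2)
    hence "h1 \<in> center G" "h2 \<in> center G"
      using derived_center by (auto simp: derived_def)
    thus ?case using eng u by (simp add: center_mult_star center_carrier)
  qed
  thus ?thesis using d by (simp add: derived_def)
qed

lemma derived_star_center:
  assumes d: "d \<in> derived G (carrier G)" and z: "z \<in> center G"
  shows "d \<star> z = \<one>"
  by (rule derived_star_eq_one[OF _ _ d])
     (use z in \<open>simp_all add: center_carrier commutator_star commutator_center_right\<close>)

section \<open>Consequences for the distinguished subgroups\<close>

text \<open>On \<open>[G, G]\<close> all \<open>\<star>\<close>-products are trivial and, as it is central in \<open>G\<close>, so is
  conjugation; every axiom then reads \<open>1 = 1\<close>.\<close>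

lemma mult_lie_algebra_derived:
  "mult_lie_algebra (G\<lparr>carrier := derived G (carrier G)\<rparr>) (\<star>)"
proof -
  let ?D = "derived G (carrier G)"
  have D: "subgroup ?D G" by (simp add: derived_is_subgroup)
  have conj: "conj_by (G\<lparr>carrier := ?D\<rparr>) x y = y" if "x \<in> ?D" "y \<in> ?D" for x y
    using conj_by_center[of x y] that derived_center[of x] derived_center[of y]
    by (simp add: conj_by_def m_inv_consistent[OF D] center_carrier)
  have star: "x \<star> y = \<one>" if "x \<in> ?D" "y \<in> ?D" for x y
    using that by (simp add: derived_star_center derived_center)
  show ?thesis
    by (intro mult_lie_algebra.intro mult_lie_algebra_axioms.intro subgroup_imp_group[OF D])
       (simp_all add: conj star subgroup.one_closed[OF D] subgroup.m_closed[OF D])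
qed

lemma comm_group_star_subgroup:
  "comm_group (G\<lparr>carrier := star_subgroup G (\<star>) (carrier G) (carrier G)\<rparr>)"
  unfolding star_subgroup_def by (rule comm_group_generate) (auto simp: star_commute)

lemma comm_group_lie_commutator_subgroup:
  "comm_group (G\<lparr>carrier := lie_commutator_subgroup G (\<star>)\<rparr>)"
proof -
  have "lie_commutator G (\<star>) x y \<otimes> lie_commutator G (\<star>) z w
      = lie_commutator G (\<star>) z w \<otimes> lie_commutator G (\<star>) x y"
    if [simp]: "x \<in> carrier G" "y \<in> carrier G" "z \<in> carrier G" "w \<in> carrier G" for x y z w
  proof -
    have "lie_commutator G (\<star>) x y \<otimes> lie_commutator G (\<star>) z w
        = (y \<star> x) \<otimes> (w \<star> z) \<otimes> (commutator G x y \<otimes> commutator G z w)"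
      if [simp]: "x \<in> carrier G" "y \<in> carrier G" "z \<in> carrier G" "w \<in> carrier G" for x y z w
      using center_commute[OF commutator_center[of x y], of "w \<star> z"]
      by (simp add: lie_commutator_def inv_star m_assoc) (simp flip: m_assoc)
    thus ?thesis
      by (simp add: star_commute[of y x w z] center_commute[OF commutator_center[of x y]])
  qed
  thus ?thesis unfolding lie_commutator_subgroup_def
    by (intro comm_group_generate) (auto simp: lie_commutator_def)
qed

text \<open>If \<open>a\<close> is in the multiplicative Lie center, \<open>a \<star> b\<close> equals the commutator
  \<open>[a, b]\<close>.\<close>

lemma star_subgroup_mult_lie_center:
  "star_subgroup G (\<star>) (mult_lie_center G (\<star>)) (mult_lie_center G (\<star>)) \<subseteq> center G"
proof -
  have "a \<star> b \<in> center G" if a: "a \<in> mult_lie_center G (\<star>)" and b: "b \<in> carrier G" for a b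
  proof -
    have a': "a \<in> carrier G" "inv (a \<star> b) \<otimes> commutator G a b = \<one>"
      using a b by (auto simp: mult_lie_center_def lie_commutator_def)
    hence "commutator G a b = a \<star> b" using b by (simp add: inv_solve_left' inv_equality)
    thus ?thesis using commutator_center[OF a'(1) b] by simp
  qed
  thus ?thesis unfolding star_subgroup_def
    by (intro generate_subgroup_incl[OF _ center_subgroup]) (auto simp: mult_lie_center_def)
qed

text \<open>For \<open>u \<in> G \<star> G\<close>, \<open>[a, b] \<star> u = [a \<star> b, u]\<close> is a commutator in the abelian group
  \<open>G \<star> G\<close>.\<close>

lemma star_subgroup_star_derived:
  "star_subgroup G (\<star>) (star_subgroup G (\<star>) (carrier G) (carrier G)) (derived G (carrier G)) = {\<one>}"
proof -
  let ?S = "star_subgroup G (\<star>) (carrier G) (carrier G)"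
  have sub: "{a \<star> b |a b. a \<in> carrier G \<and> b \<in> carrier G} \<subseteq> carrier G" by auto
  have one: "u \<star> d = \<one>" if u: "u \<in> ?S" and d: "d \<in> derived G (carrier G)" for u d
  proof -
    have uc: "u \<in> carrier G" 
      using generate_in_carrier[OF sub u[unfolded star_subgroup_def]] .
    have "d \<star> u = \<one>"
    proof (rule derived_star_eq_one[OF uc _ d])
      fix a b assume ab: "a \<in> carrier G" "b \<in> carrier G"
      hence "a \<star> b \<in> ?S" unfolding star_subgroup_def by (blast intro: generate.incl)
      hence "(a \<star> b) \<otimes> u = u \<otimes> (a \<star> b)"
        using comm_monoid.m_comm[OF comm_group.axioms(1)[OF comm_group_star_subgroup]] u by simp
      thus "commutator G a b \<star> u = \<one>"
        using ab uc by (simp add: commutator_star commutator_eq_one_iff)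
    qed
    thus ?thesis using inv_star[OF center_carrier[OF derived_center[OF d]] uc] by simp
  qed
  have "{u \<star> d |u d. u \<in> ?S \<and> d \<in> derived G (carrier G)} \<subseteq> {\<one>}"
    using one by blast
  hence "star_subgroup G (\<star>) ?S (derived G (carrier G)) \<subseteq> {\<one>}"
    by (subst star_subgroup_def) (rule generate_subgroup_incl[OF _ triv_subgroup])
  moreover have "\<one> \<in> star_subgroup G (\<star>) ?S (derived G (carrier G))"
    unfolding star_subgroup_def by (rule generate.one)
  ultimately show ?thesis by blast
qed

end

theorem proposition3p1:
  fixes G :: "('a, 'b) monoid_scheme" and star :: "'a \<Rightarrow> 'a \<Rightarrow> 'a"
  assumes "nilpotent_class_2 G"
    and "mult_lie_algebra G star"
  shows "(mult_lie_algebra (G\<lparr>carrier := derived G (carrier G)\<rparr>) star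
          \<and> trivial_structure (G\<lparr>carrier := derived G (carrier G)\<rparr>) star)
      \<and> comm_group (G\<lparr>carrier := star_subgroup G star (carrier G) (carrier G)\<rparr>)
      \<and> comm_group (G\<lparr>carrier := lie_commutator_subgroup G star\<rparr>)
      \<and> star_subgroup G star (mult_lie_center G star) (mult_lie_center G star) \<subseteq> center G
      \<and> star_subgroup G star (star_subgroup G star (carrier G) (carrier G))
           (derived G (carrier G)) = {\<one>\<^bsub>G\<^esub>}"
proof -
  interpret class_2_mult_lie_algebra G star
    using assms
    by (simp add: class_2_mult_lie_algebra.intro class_2_mult_lie_algebra_axioms.intro
          nilpotent_class_2_def)
  show ?thesis
    using mult_lie_algebra_derived comm_group_star_subgroup comm_group_lie_commutator_subgroup
      star_subgroup_mult_lie_center star_subgroup_star_derived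
    by (simp add: trivial_structure_def derived_star_center derived_center)
qed

end
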